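(* Let $\alpha>0$ and let $X_{0-}\ge0$ be a random variable with the density $$f(x)=\frac12\Big(1+\sin\frac{1}{x^\alpha}\Big),\quad x\in(0,a],$$ (and $f=0$ outside $(0,a]$), where $a\in(0,\infty)$ is defined by $\int_0^a f(x)\,\mathrm{d}x=1$. Then the physical solution $(X,\Lambda)$ of the probabilistic supercooled Stefan problem started from $X_{0-}$ is unique: any two physical solutions started from $X_{0-}$ (with the same Brownian motion $B$) have the same $\Lambda$ on $[0,\infty)$.
   Context: Let $B=(B_t)_{t\ge0}$ be a standard Brownian motion independent of $X_{0-}$. A solution of the probabilistic supercooled Stefan problem started from $X_{0-}$ is a pair $(X,\Lambda)$ with $\Lambda:[0,\infty)\to[0,1]$ deterministic such that $$X_t=X_{0-}+B_t-\Lambda_t,\quad t\ge0;\qquad \tau:=\inf\{t\ge0:\,X_t\le0\};\qquad \Lambda_t=\mathbb{P}(\tau\le t),\quad t\ge0.$$ (Then $\Lambda$ is non-decreasing and right-continuous with left limits.) Set $\Lambda_{0-}:=0$, and for $t>0$ let $\Lambda_{t-}$, $X_{t-}$ denote left limits. The solution is called physical if for all $t\ge0$ $$\Lambda_t-\Lambda_{t-}=\inf\big\{x>0:\ \mathbb{P}(\tau\ge t,\,X_{t-}\in(0,x])<x\big\}.$$ *)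

theory Defs
  imports "HOL-Probability.Probability"
begin

text \<open>Processes are indexed by \<^typ>\<open>real\<close>; only times \<open>t \<ge> 0\<close> are ever used.
  All paths are continuous.  The clause with \<open>t :: nat \<Rightarrow> real\<close> expresses independence of the
  increments over the consecutive intervals of an arbitrary finite grid
  \<open>0 \<le> t 0 < \<dots> < t n\<close>.\<close>

definition standard_brownian_motion :: "'a measure \<Rightarrow> (real \<Rightarrow> 'a \<Rightarrow> real) \<Rightarrow> bool" where
  "standard_brownian_motion M B \<longleftrightarrow>
     (\<forall>t\<ge>0. B t \<in> borel_measurable M) \<and>
     (AE \<omega> in M. B 0 \<omega> = 0) \<and>
     (\<forall>\<omega>\<in>space M. continuous_on {0..} (\<lambda>t. B t \<omega>)) \<and>
     (\<forall>s t. 0 \<le> s \<and> s < t \<longrightarrow>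
        distributed M lborel (\<lambda>\<omega>. B t \<omega> - B s \<omega>) (normal_density 0 (sqrt (t - s)))) \<and>
     (\<forall>(n::nat) (t::nat \<Rightarrow> real). 0 \<le> t 0 \<and> strict_mono_on {..n} t \<longrightarrow>
        prob_space.indep_vars M (\<lambda>_. borel) (\<lambda>i \<omega>. B (t (Suc i)) \<omega> - B (t i) \<omega>) {..<n})"

text \<open>Independence of \<^term>\<open>X0\<close> from the whole process \<^term>\<open>B\<close>, i.e. of the generated
  \<open>\<sigma>\<close>-algebras.  (\<^const>\<open>prob_space.indep_var\<close> needs both variables to have the same type.)\<close>

definition indep_of_process :: "'a measure \<Rightarrow> ('a \<Rightarrow> real) \<Rightarrow> (real \<Rightarrow> 'a \<Rightarrow> real) \<Rightarrow> bool" where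
  "indep_of_process M X0 B \<longleftrightarrow>
     prob_space.indep_set M
       (sets (vimage_algebra (space M) X0 borel))
       (sets (vimage_algebra (space M) (\<lambda>\<omega>. \<lambda>t\<in>{0..}. B t \<omega>) (PiM {0..} (\<lambda>_. borel))))"

text \<open>The value is \<open>\<infinity>\<close> if the path never hits \<open>(-\<infinity>, 0]\<close>.\<close>

definition hitting_time :: "(real \<Rightarrow> 'a \<Rightarrow> real) \<Rightarrow> 'a \<Rightarrow> ereal" where
  "hitting_time X \<omega> = Inf {ereal t | t. 0 \<le> t \<and> X t \<omega> \<le> 0}"

text \<open>Measurability of the hitting time is what makes \<open>P(\<tau> \<le> t)\<close> meaningful:
  \<^const>\<open>measure\<close> is \<open>0\<close> on non-measurable sets.\<close>

definition stefan_solution ::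
    "'a measure \<Rightarrow> ('a \<Rightarrow> real) \<Rightarrow> (real \<Rightarrow> 'a \<Rightarrow> real) \<Rightarrow> (real \<Rightarrow> 'a \<Rightarrow> real) \<Rightarrow> (real \<Rightarrow> real) \<Rightarrow> bool"
  where
  "stefan_solution M X0 B X \<Lambda> \<longleftrightarrow>
     (\<forall>t\<ge>0. \<Lambda> t \<in> {0..1}) \<and>
     (\<forall>t\<ge>0. \<forall>\<omega>\<in>space M. X t \<omega> = X0 \<omega> + B t \<omega> - \<Lambda> t) \<and>
     hitting_time X \<in> borel_measurable M \<and>
     (\<forall>t\<ge>0. \<Lambda> t = measure M {\<omega>\<in>space M. hitting_time X \<omega> \<le> ereal t})"

text \<open>\<open>g(t-)\<close> for \<open>t > 0\<close>, with a separately prescribed value \<open>g(0-) = g0\<close>.\<close>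

definition left_lim :: "real \<Rightarrow> (real \<Rightarrow> real) \<Rightarrow> real \<Rightarrow> real" where
  "left_lim g0 g t = (if t = 0 then g0 else Lim (at_left t) g)"

definition physical_solution ::
    "'a measure \<Rightarrow> ('a \<Rightarrow> real) \<Rightarrow> (real \<Rightarrow> 'a \<Rightarrow> real) \<Rightarrow> (real \<Rightarrow> 'a \<Rightarrow> real) \<Rightarrow> (real \<Rightarrow> real) \<Rightarrow> bool"
  where
  "physical_solution M X0 B X \<Lambda> \<longleftrightarrow>
     stefan_solution M X0 B X \<Lambda> \<and>
     (\<forall>t\<ge>0. \<Lambda> t - left_lim 0 \<Lambda> t =
        Inf {x. 0 < x \<and>
          measure M {\<omega>\<in>space M. hitting_time X \<omega> \<ge> ereal t \<and>
            left_lim (X0 \<omega>) (\<lambda>s. X s \<omega>) t \<in> {0<..x}} < x})"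

definition osc_density :: "real \<Rightarrow> real \<Rightarrow> real \<Rightarrow> real" where
  "osc_density \<alpha> a x = (if x \<in> {0<..a} then (1 + sin (1 / x powr \<alpha>)) / 2 else 0)"

end

theory Submission
  imports Defs
begin

text \<open>Conditionally on \<open>B\<close>, the event \<open>\<tau> \<le> t\<close> says that \<open>X0\<close> lies below the running supremum of
  \<open>\<Lambda> - B\<close> on \<open>[0, t]\<close>.  If two solutions differ by at most \<open>\<delta>\<close> in the supremum norm, then so do
  these two suprema; hence \<open>\<Lambda> t\<close> and \<open>\<Lambda>' t\<close> differ by at most the largest mass that the law of \<open>X0\<close>
  gives to an interval of length \<open>\<delta>\<close>.  As the density is \<open>< 1\<close> almost everywhere, compactness makes
  this largest mass \<open>< \<delta>\<close> unless \<open>\<delta> = 0\<close>.\<close>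

section \<open>Mass of windows of fixed length\<close>

text \<open>The hypothesis excludes atoms, so the mass of a window of length \<open>\<delta>\<close>
  depends continuously on its left endpoint. Far out it is at most \<open>\<delta> / 2\<close>, and
  on the remaining compact range it attains its maximum, which is itself the mass of one window and
  hence below \<open>\<delta>\<close>. Passing from pointwise strict bounds to a single
  \<open>c\<close> is what the uniqueness argument needs.\<close>

lemma (in real_distribution) interval_mass_bound:
  fixes \<delta> :: real
  assumes less: "\<And>y d. d > 0 \<Longrightarrow> measure M {y..y + d} < d" and "\<delta> > 0"
  shows "\<exists>c<\<delta>. \<forall>y. measure M {y..y + \<delta>} \<le> c"
proof -
  have atom: "measure M {x} = 0" for x
  proof -
    have "measure M {x} \<le> d" if "d > 0" for d
    proof -
      have "measure M {x} \<le> measure M {x..x + d}"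
        using that by (intro finite_measure_mono) auto
      then show ?thesis using less[OF that, of x] by simp
    qed
    then show ?thesis
      by (meson field_le_epsilon antisym measure_nonneg dense_ge)
  qed
  \<comment> \<open>A difference of \<open>cdf\<close> values measures a half-open interval; without
    atoms the left endpoint adds nothing.\<close>
  define h where "h y = cdf M (y + \<delta>) - cdf M y" for y
  have h: "measure M {y..y + \<delta>} = h y" for y
  proof -
    have "{y..y + \<delta>} = {y} \<union> {y<..y + \<delta>}" using \<open>\<delta> > 0\<close> by auto
    moreover have "measure M ({y} \<union> {y<..y + \<delta>}) = measure M {y} + measure M {y<..y + \<delta>}"
      by (rule finite_measure_Union) auto
    ultimately have "measure M {y..y + \<delta>} = measure M {y} + measure M {y<..y + \<delta>}" by simp
    then show ?thesis
      using cdf_diff_eq[of y "y + \<delta>"] \<open>\<delta> > 0\<close> atom by (simp add: h_def)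
  qed
  have cont: "isCont (cdf M) x" for x using atom isCont_cdf by blast
  have "isCont h y" for y
    unfolding h_def by (intro continuous_intros isCont_o2[OF _ cont] cont)
  then have cont_h: "continuous_on S h" for S
    by (simp add: continuous_at_imp_continuous_on)
  obtain K where K: "\<And>y. y \<ge> K \<Longrightarrow> cdf M y > 1 - \<delta> / 2"
    using order_tendstoD(1)[OF cdf_lim_at_top_prob, of "1 - \<delta> / 2"] \<open>\<delta> > 0\<close>
    by (auto simp: eventually_at_top_linorder)
  obtain J where J: "\<And>y. y \<le> J \<Longrightarrow> cdf M y < \<delta> / 2"
    using order_tendstoD(2)[OF cdf_lim_at_bot, of "\<delta> / 2"] \<open>\<delta> > 0\<close>
    by (auto simp: eventually_at_bot_linorder)
  \<comment> \<open>A window starting left of \<open>I\<close> ends below \<open>J\<close>, one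
    starting right of \<open>I\<close> starts above \<open>K\<close>; either way it lies in a tail
    of mass at most \<open>\<delta> / 2\<close>. The maximum with \<open>J\<close> keeps
    \<open>I\<close> nonempty.\<close>
  define I where "I = {J - \<delta>..max K J}"
  have "compact I" "I \<noteq> {}" using \<open>\<delta> > 0\<close> by (auto simp: I_def)
  from continuous_attains_sup[OF this cont_h]
  obtain z where z: "\<And>y. y \<in> I \<Longrightarrow> h y \<le> h z" by blast
  have "h y \<le> max (h z) (\<delta> / 2)" for y
  proof -
    consider "y \<in> I" | "y + \<delta> \<le> J" | "K \<le> y" unfolding I_def by fastforce
    then have "h y \<le> h z \<or> h y \<le> \<delta> / 2"
    proof cases
      case 1
      then show ?thesis using z by blast
    next
      case 2
      from J[OF this] have "h y \<le> \<delta> / 2" using cdf_nonneg[of y] unfolding h_def by linarith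
      then show ?thesis ..
    next
      case 3
      from K[OF this] have "h y \<le> \<delta> / 2"
        using cdf_bounded_prob[of "y + \<delta>"] unfolding h_def by linarith
      then show ?thesis ..
    qed
    then show ?thesis by linarith
  qed
  moreover have "max (h z) (\<delta> / 2) < \<delta>" using less[OF \<open>\<delta> > 0\<close>, of z] \<open>\<delta> > 0\<close> h by simp
  ultimately show ?thesis using h by metis
qed

text \<open>By independence the joint law is a product. Integrating over \<open>Y\<close> last, the
  section of the strip \<open>S\<close> at \<open>y\<close> is \<open>{y..y + \<delta>}\<close>, of
  mass at most \<open>c\<close>, and \<open>c\<close> survives averaging over the law of
  \<open>Y\<close>.\<close>

lemma (in prob_space) indep_var_window_le:
  fixes X Y :: "'a \<Rightarrow> real"
  assumes indep: "indep_var borel X borel Y"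
    and le: "\<And>y. measure (distr M borel X) {y..y + \<delta>} \<le> c"
  shows "prob {\<omega>\<in>space M. Y \<omega> \<le> X \<omega> \<and> X \<omega> \<le> Y \<omega> + \<delta>} \<le> c"
proof -
  have [measurable]: "random_variable borel X" "random_variable borel Y"
    using indep by (auto dest: indep_var_rv1 indep_var_rv2)
  have joint: "distr M (borel \<Otimes>\<^sub>M borel) (\<lambda>x. (X x, Y x)) = distr M borel X \<Otimes>\<^sub>M distr M borel Y"
    using indep by (simp add: indep_var_distribution_eq)
  interpret PX: prob_space "distr M borel X" by (rule prob_space_distr) measurable
  interpret PY: prob_space "distr M borel Y" by (rule prob_space_distr) measurable
  interpret pair_prob_space "distr M borel X" "distr M borel Y" ..
  define S where "S = {p. snd p \<le> fst p \<and> fst p \<le> snd p + \<delta>}"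
  have "closed S"
    unfolding S_def by (intro closed_Collect_conj closed_Collect_le continuous_intros)
  then have S[measurable]: "S \<in> sets (borel \<Otimes>\<^sub>M borel)"
    unfolding borel_prod by (rule borel_closed)
  have c: "c \<ge> 0" using le[of 0] measure_nonneg order_trans by blast
  have sl: "(\<lambda>x. (x, y)) -` S = {y..y + \<delta>}" for y by (auto simp: S_def)
  have "emeasure M {\<omega>\<in>space M. Y \<omega> \<le> X \<omega> \<and> X \<omega> \<le> Y \<omega> + \<delta>}
      = emeasure (distr M (borel \<Otimes>\<^sub>M borel) (\<lambda>x. (X x, Y x))) S"
    by (subst emeasure_distr[OF _ S]) (auto simp: S_def intro!: arg_cong[of _ _ "emeasure M"])
  also have "\<dots> = emeasure (distr M borel X \<Otimes>\<^sub>M distr M borel Y) S"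
    by (simp only: joint)
  also have "\<dots> = (\<integral>\<^sup>+y. emeasure (distr M borel X) {y..y + \<delta>} \<partial>distr M borel Y)"
    by (subst emeasure_pair_measure_alt2) (use S in \<open>auto simp: sl cong: sets_pair_measure_cong\<close>)
  also have "\<dots> \<le> (\<integral>\<^sup>+y. ennreal c \<partial>distr M borel Y)"
    using le c by (intro nn_integral_mono) (simp add: PX.emeasure_eq_measure ennreal_leI)
  also have "\<dots> = ennreal c"
    by (simp add: PY.emeasure_space_1[simplified])
  finally show ?thesis using c by (simp add: measure_def enn2real_leI)
qed

section \<open>Hitting times and right-continuity of the loss\<close>

text \<open>The infimum is attained: were the path positive at the hitting time \<open>r\<close>,
  right-continuity would keep it positive up to some \<open>b > r\<close>. Together with the absence
  of earlier hits this pushes the infimum up to \<open>b\<close>. One-sided limits are the right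
  notion here because \<Lambda> may jump.\<close>

lemma hitting_time_le_iff:
  assumes cont: "\<And>s. 0 \<le> s \<Longrightarrow> ((\<lambda>r. X r \<omega>) \<longlongrightarrow> X s \<omega>) (at_right s)"
  shows "hitting_time X \<omega> \<le> ereal t \<longleftrightarrow> (\<exists>s. 0 \<le> s \<and> s \<le> t \<and> X s \<omega> \<le> 0)"
proof
  assume le: "hitting_time X \<omega> \<le> ereal t"
  have ge0: "0 \<le> hitting_time X \<omega>"
    unfolding hitting_time_def by (intro Inf_greatest) auto
  obtain r where r: "hitting_time X \<omega> = ereal r"
    using le ge0 by (cases "hitting_time X \<omega>") auto
  have "0 \<le> r" "r \<le> t" using ge0 le r by auto
  have lower: "r \<le> s" if "0 \<le> s" "X s \<omega> \<le> 0" for s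
  proof -
    have "hitting_time X \<omega> \<le> ereal s"
      unfolding hitting_time_def using that by (intro Inf_lower) auto
    then show ?thesis using r by simp
  qed
  have "X r \<omega> \<le> 0"
  proof (rule ccontr)
    assume "\<not> X r \<omega> \<le> 0"
    then have "eventually (\<lambda>s. 0 < X s \<omega>) (at_right r)"
      using order_tendstoD(1)[OF cont[OF \<open>0 \<le> r\<close>]] by simp
    then obtain b where b: "b > r" "\<And>s. r < s \<Longrightarrow> s < b \<Longrightarrow> 0 < X s \<omega>"
      unfolding eventually_at_right_field by auto
    have "b \<le> s" if "0 \<le> s" "X s \<omega> \<le> 0" for s
      using lower[OF that] b(2)[of s] \<open>\<not> X r \<omega> \<le> 0\<close> that(2) by (cases "s = r"; cases "s < b") auto
    then have "ereal b \<le> hitting_time X \<omega>"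
      unfolding hitting_time_def by (intro Inf_greatest) auto
    then show False using r b(1) by simp
  qed
  then show "\<exists>s. 0 \<le> s \<and> s \<le> t \<and> X s \<omega> \<le> 0" using \<open>0 \<le> r\<close> \<open>r \<le> t\<close> by blast
next
  assume "\<exists>s. 0 \<le> s \<and> s \<le> t \<and> X s \<omega> \<le> 0"
  then obtain s where s: "0 \<le> s" "s \<le> t" "X s \<omega> \<le> 0" by blast
  then have "hitting_time X \<omega> \<le> ereal s"
    unfolding hitting_time_def by (intro Inf_lower) auto
  then show "hitting_time X \<omega> \<le> ereal t" using s(2) by (meson ereal_less_eq(3) order_trans)
qed

text \<open>Continuity from above of the measure: along a sequence decreasing to \<open>s\<close>,
  the events that the hitting time is at most \<open>u n\<close> shrink to the same event for
  \<open>s\<close>. The bound \<open>s + 1\<close> is an arbitrary number above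
  \<open>s\<close>.\<close>

lemma (in prob_space) stefan_solution_right_continuous:
  assumes sol: "stefan_solution M X0 B X \<Lambda>" and "0 \<le> s"
  shows "(\<Lambda> \<longlongrightarrow> \<Lambda> s) (at_right s)"
proof (rule tendsto_at_right_sequentially[where b="s + 1"])
  fix u :: "nat \<Rightarrow> real"
  assume u: "decseq u" "u \<longlonglongrightarrow> s" "\<And>n. s < u n"
  have [measurable]: "hitting_time X \<in> borel_measurable M"
    and eq: "\<And>t. t \<ge> 0 \<Longrightarrow> \<Lambda> t = prob {\<omega>\<in>space M. hitting_time X \<omega> \<le> ereal t}"
    using sol by (auto simp: stefan_solution_def)
  let ?A = "\<lambda>t. {\<omega>\<in>space M. hitting_time X \<omega> \<le> ereal t}"
  have "(\<lambda>n. prob (?A (u n))) \<longlonglongrightarrow> prob (\<Inter>n. ?A (u n))"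
    using u(1) by (intro finite_Lim_measure_decseq)
      (auto simp: decseq_def elim!: order_trans)
  also have "(\<Inter>n. ?A (u n)) = ?A s"
  proof (intro set_eqI iffI)
    fix \<omega> assume "\<omega> \<in> (\<Inter>n. ?A (u n))"
    moreover from u(2) have "(\<lambda>n. ereal (u n)) \<longlonglongrightarrow> ereal s" by simp
    ultimately show "\<omega> \<in> ?A s" by (auto intro: LIMSEQ_le_const)
  next
    fix \<omega> assume "\<omega> \<in> ?A s"
    moreover have "ereal s \<le> ereal (u n)" for n using u(3)[of n] by simp
    ultimately show "\<omega> \<in> (\<Inter>n. ?A (u n))" by (auto intro: order_trans)
  qed
  finally show "(\<lambda>n. \<Lambda> (u n)) \<longlonglongrightarrow> \<Lambda> s"
    using eq u(3) \<open>0 \<le> s\<close> by (simp add: less_imp_le order_trans[of 0 s])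
qed simp

section \<open>Comparison of two solutions driven by the same data\<close>

text \<open>Transfers independence from the whole path to a real-valued functional of it: the
  preimages under \<open>Y\<close> form a sub-\<sigma>-algebra of the one generated by
  \<open>B\<close>, and independence passes to subfamilies.\<close>

lemma (in prob_space) indep_var_of_process:
  fixes X0 Y :: "'a \<Rightarrow> real"
  assumes indep: "indep_of_process M X0 B"
    and X0: "random_variable borel X0"
    and Y: "Y \<in> borel_measurable
      (vimage_algebra (space M) (\<lambda>\<omega>. \<lambda>t\<in>{0..}. B t \<omega>) (PiM {0..} (\<lambda>_. borel)))"
      (is "_ \<in> borel_measurable ?N")
  shows "indep_var borel X0 borel Y"
proof -
  have ind: "indep_set (sets (vimage_algebra (space M) X0 borel)) (sets ?N)"
    using indep by (simp add: indep_of_process_def)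
  have sub: "{Y -` A \<inter> space M |A. A \<in> sets borel} \<subseteq> sets ?N"
    using measurable_sets[OF Y] by auto
  have "sets ?N \<subseteq> events" using indep_setD_ev2[OF ind] .
  then have "random_variable borel Y"
    using sub by (auto intro!: measurableI)
  moreover have "sigma_sets (space M) {Y -` A \<inter> space M |A. A \<in> sets borel} \<subseteq> sets ?N"
    using sets.sigma_sets_subset[OF sub] by simp
  then have "indep_set (sets (vimage_algebra (space M) X0 borel))
      (sigma_sets (space M) {Y -` A \<inter> space M |A. A \<in> sets borel})"
    using ind unfolding indep_sets2_eq by blast
  ultimately show ?thesis
    using X0 by (simp add: indep_var_eq sets_vimage_algebra)
qed

text \<open>Both solutions share \<open>X0\<close> and \<open>B\<close>, so the events can be
  compared path by path. With \<open>m\<close> the running supremum of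
  \<open>\<Lambda>' - B\<close>, a path absorbed by time \<open>t\<close> in the first solution but
  not in the second has \<open>X0\<close> in \<open>{m..m + \<delta>}\<close>. As \<open>m\<close>
  depends on \<open>B\<close> only, this window is independent of \<open>X0\<close> and the mass
  bound applies.\<close>

lemma (in prob_space) stefan_solution_diff_le:
  assumes cont: "\<And>\<omega>. \<omega> \<in> space M \<Longrightarrow> continuous_on {0..} (\<lambda>t. B t \<omega>)"
    and indep: "indep_of_process M X0 B" and X0: "random_variable borel X0"
    and sol: "stefan_solution M X0 B X \<Lambda>" and sol': "stefan_solution M X0 B X' \<Lambda>'"
    and \<delta>: "\<And>s. 0 \<le> s \<Longrightarrow> \<bar>\<Lambda> s - \<Lambda>' s\<bar> \<le> \<delta>"
    and c: "\<And>y. measure (distr M borel X0) {y..y + \<delta>} \<le> c"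
    and "0 \<le> t"
  shows "\<Lambda> t - \<Lambda>' t \<le> c"
proof -
  have B_right: "((\<lambda>r. B r \<omega>) \<longlongrightarrow> B s \<omega>) (at_right s)" if "\<omega> \<in> space M" "0 \<le> s" for \<omega> s
  proof -
    have "((\<lambda>r. B r \<omega>) \<longlongrightarrow> B s \<omega>) (at s within {0..})"
      using cont[OF that(1)] that(2) by (simp add: continuous_on_def)
    then show ?thesis by (rule tendsto_within_subset) (use that in auto)
  qed
  have X_right: "((\<lambda>r. Z r \<omega>) \<longlongrightarrow> Z s \<omega>) (at_right s)"
    if "stefan_solution M X0 B Z L" "\<omega> \<in> space M" "0 \<le> s" for Z L \<omega> s
  proof -
    have Z: "\<And>r. 0 \<le> r \<Longrightarrow> Z r \<omega> = X0 \<omega> + B r \<omega> - L r"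
      using that by (simp add: stefan_solution_def)
    have "((\<lambda>r. X0 \<omega> + B r \<omega> - L r) \<longlongrightarrow> Z s \<omega>) (at_right s)"
      using Z[OF that(3)] B_right[OF that(2,3)] stefan_solution_right_continuous[OF that(1,3)]
      by (auto intro!: tendsto_intros)
    \<comment> \<open>The formula for \<open>Z r\<close> is available for \<open>0 \<le> r\<close>,
      which includes a right neighbourhood of \<open>s\<close>.\<close>
    moreover have "eventually (\<lambda>r. X0 \<omega> + B r \<omega> - L r = Z r \<omega>) (at_right s)"
      using Z that(3) by (auto simp: eventually_at_filter intro!: always_eventually)
    ultimately show ?thesis by (rule Lim_transform_eventually)
  qed
  have hit: "hitting_time Z \<omega> \<le> ereal t \<longleftrightarrow> (\<exists>s. 0 \<le> s \<and> s \<le> t \<and> X0 \<omega> \<le> L s - B s \<omega>)"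
    if "stefan_solution M X0 B Z L" "\<omega> \<in> space M" for Z L \<omega>
  proof -
    have "Z s \<omega> \<le> 0 \<longleftrightarrow> X0 \<omega> \<le> L s - B s \<omega>" if "0 \<le> s" for s
      using \<open>stefan_solution M X0 B Z L\<close> \<open>\<omega> \<in> space M\<close> that
      unfolding stefan_solution_def by (smt (verit))
    then show ?thesis
      using hitting_time_le_iff[of Z \<omega> t, OF X_right[OF that]] by blast
  qed

  \<comment> \<open>Countability of \<open>D\<close> makes the supremum \<open>m\<close> measurable.
    The rationals reach every \<open>s < t\<close> from the right; the endpoint \<open>t\<close>
    cannot be approached from the right inside \<open>{0..t}\<close> and is added by hand.\<close>
  define D where "D = insert t (\<rat> \<inter> {0..t})"
  have D: "countable D" "D \<noteq> {}" "D \<subseteq> {0..t}" "t \<in> D"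
    using \<open>0 \<le> t\<close> countable_rat by (auto simp: D_def)
  define m where "m \<omega> = (SUP s\<in>D. \<Lambda>' s - B s \<omega>)" for \<omega>
  have bdd: "bdd_above ((\<lambda>s. \<Lambda>' s - B s \<omega>) ` D)" if "\<omega> \<in> space M" for \<omega>
  proof -
    have "continuous_on {0..t} (\<lambda>s. B s \<omega>)"
      using cont[OF that] by (rule continuous_on_subset) auto
    then have "bounded ((\<lambda>s. B s \<omega>) ` {0..t})"
      by (intro compact_imp_bounded compact_continuous_image) auto
    then obtain b where "\<And>s. s \<in> {0..t} \<Longrightarrow> \<bar>B s \<omega>\<bar> \<le> b"
      unfolding bounded_iff by fastforce
    moreover have "\<And>s. s \<in> {0..t} \<Longrightarrow> \<Lambda>' s \<le> 1"
      using sol' by (simp add: stefan_solution_def)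
    ultimately have "\<Lambda>' s - B s \<omega> \<le> 1 + b" if "s \<in> D" for s
      using that D(3) by (smt (verit) subsetD)
    then show ?thesis by (auto intro!: bdd_aboveI2)
  qed
  \<comment> \<open>The countable supremum dominates all times: a value above \<open>m\<close> at
    \<open>s < t\<close> would persist, by right-continuity, at some rational time in
    \<open>D\<close>.\<close>
  have m_upper: "\<Lambda>' s - B s \<omega> \<le> m \<omega>" if "\<omega> \<in> space M" "0 \<le> s" "s \<le> t" for \<omega> s
  proof (cases "s = t")
    case True
    then show ?thesis unfolding m_def using bdd[OF that(1)] D(4) by (intro cSUP_upper) auto
  next
    case False
    then have "s < t" using that by simp
    show ?thesis
    proof (rule ccontr)
      assume "\<not> \<Lambda>' s - B s \<omega> \<le> m \<omega>"
      moreover have "((\<lambda>r. \<Lambda>' r - B r \<omega>) \<longlongrightarrow> \<Lambda>' s - B s \<omega>) (at_right s)"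
        using B_right[OF that(1,2)] stefan_solution_right_continuous[OF sol' that(2)]
        by (rule tendsto_diff[rotated])
      ultimately have "eventually (\<lambda>r. m \<omega> < \<Lambda>' r - B r \<omega>) (at_right s)"
        by (intro order_tendstoD(1)) auto
      then obtain b where b: "b > s" "\<And>r. s < r \<Longrightarrow> r < b \<Longrightarrow> m \<omega> < \<Lambda>' r - B r \<omega>"
        unfolding eventually_at_right_field by auto
      obtain q where q: "q \<in> \<rat>" "s < q" "q < min b t"
        using Rats_dense_in_real[of s "min b t"] b(1) \<open>s < t\<close> by auto
      then have "\<Lambda>' q - B q \<omega> \<le> m \<omega>"
        unfolding m_def using bdd[OF that(1)] that(2) by (intro cSUP_upper) (auto simp: D_def)
      with b(2)[of q] q show False by simp
    qed
  qed
  let ?N = "vimage_algebra (space M) (\<lambda>\<omega>. \<lambda>t\<in>{0..}. B t \<omega>) (PiM {0..} (\<lambda>_. borel))"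
  \<comment> \<open>Measurability is tracked in \<open>?N\<close>, the \<sigma>-algebra of the
    Brownian path, rather than in \<open>M\<close>, because independence of \<open>m\<close> from
    \<open>X0\<close> is drawn from it.\<close>
  have BN: "B s \<in> borel_measurable ?N" if "0 \<le> s" for s
  proof -
    have "(\<lambda>\<omega>. \<lambda>t\<in>{0..}. B t \<omega>) \<in> measurable ?N (PiM {0..} (\<lambda>_. borel))"
      by (rule measurable_vimage_algebra1) (auto simp: space_PiM)
    from measurable_compose[OF this measurable_component_singleton[of s]] that
    show ?thesis by simp
  qed
  have "m \<in> borel_measurable ?N"
    unfolding m_def using D bdd BN by (intro borel_measurable_cSUP borel_measurable_diff) auto
  then have ind: "indep_var borel X0 borel m"
    using indep_var_of_process[OF indep X0] by simp
  then have [measurable]: "random_variable borel X0" "random_variable borel m"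
    by (auto dest: indep_var_rv1 indep_var_rv2)
  have [measurable]: "hitting_time X \<in> borel_measurable M" "hitting_time X' \<in> borel_measurable M"
    using sol sol' by (auto simp: stefan_solution_def)
  let ?A = "{\<omega>\<in>space M. hitting_time X \<omega> \<le> ereal t}"
  let ?A' = "{\<omega>\<in>space M. hitting_time X' \<omega> \<le> ereal t}"
  let ?C = "{\<omega>\<in>space M. m \<omega> \<le> X0 \<omega> \<and> X0 \<omega> \<le> m \<omega> + \<delta>}"
  have "?A \<subseteq> ?A' \<union> ?C"
  proof
    fix \<omega> assume "\<omega> \<in> ?A"
    then have w: "\<omega> \<in> space M" by simp
    from \<open>\<omega> \<in> ?A\<close> obtain s where s: "0 \<le> s" "s \<le> t" "X0 \<omega> \<le> \<Lambda> s - B s \<omega>"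
      using hit[OF sol w] by auto
    then have up: "X0 \<omega> \<le> m \<omega> + \<delta>" using m_upper[OF w s(1,2)] \<delta>[OF s(1)] by linarith
    \<comment> \<open>If \<open>X0\<close> is strictly below the supremum, some time in
      \<open>D\<close> witnesses absorption in the second solution. The supremum need not be
      attained, so the boundary case \<open>X0 \<omega> = m \<omega>\<close> is put into the closed
      window \<open>?C\<close>.\<close>
    show "\<omega> \<in> ?A' \<union> ?C"
    proof (cases "X0 \<omega> < m \<omega>")
      case True
      then obtain r where "r \<in> D" "X0 \<omega> < \<Lambda>' r - B r \<omega>"
        unfolding m_def using less_cSUP_iff[OF D(2) bdd[OF w]] by auto
      then have "hitting_time X' \<omega> \<le> ereal t"
        using D(3) unfolding hit[OF sol' w] by (intro exI[of _ r]) auto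
      then show ?thesis using w by simp
    next
      case False
      then show ?thesis using w up by simp
    qed
  qed
  then have "prob ?A \<le> prob (?A' \<union> ?C)" by (intro finite_measure_mono) auto
  also have "\<dots> \<le> prob ?A' + prob ?C" by (intro measure_Un_le) auto
  also have "prob ?C \<le> c" by (rule indep_var_window_le[OF ind c])
  finally show ?thesis
    using sol sol' \<open>0 \<le> t\<close> by (simp add: stefan_solution_def)
qed

text \<open>The comparison is a strict contraction at the scale of the actual distance: if the
  sup-distance \<open>\<delta>\<close> were positive, all differences would be bounded by some
  \<open>c < \<delta>\<close>, contradicting that \<open>\<delta>\<close> is the least upper bound.
  Taking the supremum over all times at once avoids any induction in time; it is finite since both
  functions take values in \<open>{0..1}\<close>.\<close>

lemma (in prob_space) stefan_solution_unique:
  assumes cont: "\<And>\<omega>. \<omega> \<in> space M \<Longrightarrow> continuous_on {0..} (\<lambda>t. B t \<omega>)"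
    and indep: "indep_of_process M X0 B" and X0: "random_variable borel X0"
    and less: "\<And>y d. d > 0 \<Longrightarrow> measure (distr M borel X0) {y..y + d} < d"
    and sol: "stefan_solution M X0 B X \<Lambda>" and sol': "stefan_solution M X0 B X' \<Lambda>'"
    and "0 \<le> t"
  shows "\<Lambda> t = \<Lambda>' t"
proof -
  define \<delta> where "\<delta> = (SUP s\<in>{0..}. \<bar>\<Lambda> s - \<Lambda>' s\<bar>)"
  have "\<Lambda> s \<in> {0..1}" "\<Lambda>' s \<in> {0..1}" if "0 \<le> s" for s
    using sol sol' that by (auto simp: stefan_solution_def)
  then have "\<bar>\<Lambda> s - \<Lambda>' s\<bar> \<le> 1" if "0 \<le> s" for s
    using that by (fastforce simp: abs_if)
  then have "bdd_above ((\<lambda>s. \<bar>\<Lambda> s - \<Lambda>' s\<bar>) ` {0..})"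
    by (auto intro!: bdd_aboveI2)
  then have \<delta>: "\<bar>\<Lambda> s - \<Lambda>' s\<bar> \<le> \<delta>" if "0 \<le> s" for s
    unfolding \<delta>_def using that by (intro cSUP_upper) auto
  have "\<delta> \<le> 0"
  proof (rule ccontr)
    assume "\<not> \<delta> \<le> 0"
    then obtain c where c: "c < \<delta>" "\<And>y. measure (distr M borel X0) {y..y + \<delta>} \<le> c"
      using real_distribution.interval_mass_bound[OF real_distribution_distr[OF X0] less, of \<delta>] by auto
    \<comment> \<open>The comparison is one-sided, so it is used a second time with the two
      solutions exchanged.\<close>
    have "\<bar>\<Lambda> s - \<Lambda>' s\<bar> \<le> c" if "0 \<le> s" for s
      using stefan_solution_diff_le[OF cont indep X0 sol sol' \<delta> c(2) that]
        stefan_solution_diff_le[OF cont indep X0 sol' sol _ c(2) that] \<delta>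
      by (simp add: abs_le_iff abs_minus_commute)
    then have "\<delta> \<le> c" unfolding \<delta>_def by (intro cSUP_least) auto
    then show False using c(1) by simp
  qed
  then show ?thesis using \<delta>[OF \<open>0 \<le> t\<close>] by simp
qed

section \<open>The oscillating density\<close>

text \<open>The integral of \<open>f\<close> over the interval is compared with that of the constant
  1; the inequality is strict because the integrands differ almost everywhere on a set of positive
  finite measure.\<close>

lemma distributed_interval_less:
  fixes X0 :: "'a \<Rightarrow> real" and f :: "real \<Rightarrow> real"
  assumes X0: "distributed M lborel X0 f" and f: "AE x in lborel. f x < 1" and "d > 0"
  shows "measure (distr M borel X0) {y..y + d} < d"
proof -
  have [measurable]: "X0 \<in> borel_measurable M" "(\<lambda>x. ennreal (f x)) \<in> borel_measurable borel"
    using distributed_measurable[OF X0] distributed_borel_measurable[OF X0] by simp_all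
  let ?I = "{y..y + d}"
  have I: "emeasure lborel ?I = ennreal d" using \<open>d > 0\<close> by simp
  have "emeasure (distr M borel X0) ?I = emeasure (distr M lborel X0) ?I"
    by (simp add: emeasure_distr)
  also have "\<dots> = (\<integral>\<^sup>+x. ennreal (f x) * indicator ?I x \<partial>lborel)"
    unfolding distributed_distr_eq_density[OF X0] by (rule emeasure_density) auto
  also have "\<dots> < (\<integral>\<^sup>+x. indicator ?I x \<partial>lborel)"
  proof (rule nn_integral_less)
    show le: "AE x in lborel. ennreal (f x) * indicator ?I x \<le> indicator ?I x"
      using f by eventually_elim (auto split: split_indicator intro: ennreal_le_1[THEN iffD2])
    have "(\<integral>\<^sup>+x. ennreal (f x) * indicator ?I x \<partial>lborel) \<le> (\<integral>\<^sup>+x. indicator ?I x \<partial>lborel)"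
      by (rule nn_integral_mono_AE[OF le])
    also have "\<dots> < \<infinity>" using I by simp
    finally show "(\<integral>\<^sup>+x. ennreal (f x) * indicator ?I x \<partial>lborel) \<noteq> \<infinity>" by simp
    \<comment> \<open>On \<open>?I\<close> the reversed inequality says \<open>1 \<le> f x\<close>,
      against \<open>f x < 1\<close>; so it would force \<open>?I\<close> to be a null set.\<close>
    show "\<not> (AE x in lborel. indicator ?I x \<le> ennreal (f x) * indicator ?I x)"
    proof
      assume "AE x in lborel. indicator ?I x \<le> ennreal (f x) * indicator ?I x"
      with f have "AE x in lborel. x \<notin> ?I"
        by eventually_elim (auto split: split_indicator_asm simp: ennreal_ge_1)
      then have "emeasure lborel ?I = 0" by (subst (asm) AE_iff_measurable[of ?I]) auto
      then show False using I \<open>d > 0\<close> by simp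
    qed
  qed auto
  also have "\<dots> = ennreal d" using I by simp
  finally have "emeasure (distr M borel X0) ?I < ennreal d" .
  then show ?thesis
    unfolding measure_def using \<open>d > 0\<close>
    by (cases "emeasure (distr M borel X0) ?I") (auto simp: ennreal_less_iff)
qed

text \<open>The value 1 is reached only where the sine equals 1, and \<alpha> > 0 lets this equation
  be solved for \<open>x\<close>, leaving countably many points.\<close>

lemma osc_density_less_1:
  assumes "\<alpha> > 0"
  shows "AE x in lborel. osc_density \<alpha> a x < 1"
proof -
  \<comment> \<open>These are the solutions of
    \<open>1 / x powr \<alpha> = (2 * n + 1 / 2) * pi\<close>. Negative \<open>n\<close> give a
    negative base for \<open>powr\<close>; whatever points they add, \<open>S\<close> stays
    countable.\<close>
  define S where "S = range (\<lambda>n::int. (1 / ((2 * n + 1 / 2) * pi)) powr (1 / \<alpha>))"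
  have "osc_density \<alpha> a x < 1" if "x \<notin> S" for x
  proof (cases "x \<in> {0<..a}")
    case True
    have "sin (1 / x powr \<alpha>) \<noteq> 1"
    proof
      assume "sin (1 / x powr \<alpha>) = 1"
      then obtain n :: int where "1 / x powr \<alpha> = (2 * n + 1 / 2) * pi" by (auto simp: sin_eq_1)
      then have "x powr \<alpha> = 1 / ((2 * n + 1 / 2) * pi)" by (metis divide_divide_eq_right div_by_1 mult_1)
      then have "(x powr \<alpha>) powr (1 / \<alpha>) \<in> S" unfolding S_def by auto
      moreover have "(x powr \<alpha>) powr (1 / \<alpha>) = x"
        using assms True by (simp add: powr_powr)
      ultimately show False using that by simp
    qed
    then have "sin (1 / x powr \<alpha>) < 1" by (simp add: less_le)
    then show ?thesis using True by (simp add: osc_density_def)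
  qed (auto simp: osc_density_def)
  moreover have "S \<in> null_sets lborel"
    unfolding S_def by (intro countable_imp_null_set_lborel) simp
  ultimately show ?thesis by (intro AE_I'[of S]) auto
qed

theorem corollary1p4:
  fixes M :: "'a measure"
    and B :: "real \<Rightarrow> 'a \<Rightarrow> real"
    and X0 :: "'a \<Rightarrow> real"
    and X X' :: "real \<Rightarrow> 'a \<Rightarrow> real"
    and \<Lambda> \<Lambda>' :: "real \<Rightarrow> real"
    and \<alpha> a :: real
  assumes "prob_space M"
    and "standard_brownian_motion M B"
    and "indep_of_process M X0 B"
    and "\<alpha> > 0"
    and "a > 0"
    and "(LINT x:{0<..a}|lborel. osc_density \<alpha> a x) = 1"
    and "AE \<omega> in M. X0 \<omega> \<ge> 0"
    and "distributed M lborel X0 (osc_density \<alpha> a)"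
    and "physical_solution M X0 B X \<Lambda>"
    and "physical_solution M X0 B X' \<Lambda>'"
  shows "\<forall>t\<ge>0. \<Lambda> t = \<Lambda>' t"
proof -
  interpret prob_space M by fact
  have cont: "\<And>\<omega>. \<omega> \<in> space M \<Longrightarrow> continuous_on {0..} (\<lambda>t. B t \<omega>)"
    using assms(2) by (simp add: standard_brownian_motion_def)
  have X0: "random_variable borel X0"
    using distributed_measurable[OF assms(8)] by simp
  show ?thesis
    using stefan_solution_unique[OF cont assms(3) X0
        distributed_interval_less[OF assms(8) osc_density_less_1[OF assms(4)]]] assms(9,10)
    by (auto simp: physical_solution_def)
qed

end
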